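(* If a $(v,k,\lambda)$-BIBD admits a $0$-ULSE $\ell$-colouring with $\ell<v$, then \[\frac{3+\sqrt{4k+1}}{2}\leq \ell\leq \frac{k}{2}+1.\]
   Context: For positive integers $v,k,\lambda$ with $2\le k<v$, a $(v,k,\lambda)$-BIBD is a pair $(V,\mathcal{B})$ where $V$ is a set of $v$ points and $\mathcal{B}$ is a collection of $k$-element subsets of $V$ (blocks) such that every pair of distinct points lies in exactly $\lambda$ blocks. An $\ell$-colouring is a surjective map from $V$ onto a set of $\ell$ colours. A $0$-ULSE $\ell$-colouring is an $\ell$-colouring such that $(\ell-1)$ divides $k$ and in every block exactly one colour does not appear, while each of the other $\ell-1$ colours appears exactly $\frac{k}{\ell-1}$ times in that block. It is nontrivial if $\ell<v$. *)

theory Defs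
  imports Complex_Main "HOL-Library.Multiset"
begin

text \<open>Blocks form a multiset, so that repeated blocks are allowed and counted with
  multiplicity, as is standard in design theory; a design without repeated blocks is a
  special case.\<close>

definition bibd :: "nat \<Rightarrow> nat \<Rightarrow> nat \<Rightarrow> 'a set \<Rightarrow> 'a set multiset \<Rightarrow> bool" where
  "bibd v k lam V \<B> \<longleftrightarrow>
     2 \<le> k \<and> k < v \<and> 0 < lam \<and>
     finite V \<and> card V = v \<and>
     (\<forall>B\<in>#\<B>. B \<subseteq> V \<and> card B = k) \<and>
     (\<forall>x\<in>V. \<forall>y\<in>V. x \<noteq> y \<longrightarrow> size {#B \<in># \<B>. x \<in> B \<and> y \<in> B#} = lam)"

definition colouring :: "nat \<Rightarrow> 'a set \<Rightarrow> 'c set \<Rightarrow> ('a \<Rightarrow> 'c) \<Rightarrow> bool" where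
  "colouring l V C f \<longleftrightarrow> finite C \<and> card C = l \<and> f ` V = C"

text \<open>For \<open>l = 1\<close> the divisor \<open>l - 1\<close> is \<open>0\<close>, which divides no positive \<open>k\<close>;
  since \<open>l - 1\<close> divides \<open>k\<close>, the \<open>div\<close> below is exact.\<close>

definition zero_ULSE_colouring ::
    "nat \<Rightarrow> nat \<Rightarrow> 'a set \<Rightarrow> 'a set multiset \<Rightarrow> 'c set \<Rightarrow> ('a \<Rightarrow> 'c) \<Rightarrow> bool" where
  "zero_ULSE_colouring l k V \<B> C f \<longleftrightarrow>
     colouring l V C f \<and> (l - 1) dvd k \<and>
     (\<forall>B\<in>#\<B>. \<exists>!c. c \<in> C \<and> c \<notin> f ` B) \<and>
     (\<forall>B\<in>#\<B>. \<forall>d \<in> C \<inter> f ` B. card {x \<in> B. f x = d} = k div (l - 1))"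

end

theory Submission imports Defs begin

text \<open>Put \<open>m = k / (l - 1)\<close> and fix a point \<open>x\<close> lying in \<open>r\<close> blocks. Counting pairs \<open>(y, B)\<close> with
  \<open>y \<noteq> x\<close> and \<open>x, y \<in> B\<close>, first for all \<open>y\<close> and then for the \<open>y\<close> of the same colour as \<open>x\<close>, gives
  \<open>(v - 1) \<lambda> = r (k - 1)\<close> and \<open>(n - 1) \<lambda> = r (m - 1)\<close>, where \<open>n\<close> is the size of the colour class of
  \<open>x\<close>. Hence \<open>(n - 1) (k - 1) = (v - 1) (m - 1)\<close>, and summation over the \<open>l\<close> colours yields
  \<open>(v - l) (k - 1) = l (v - 1) (m - 1)\<close>. As \<open>v > l\<close>, this forces \<open>m \<ge> 2\<close>, which is the upper bound.
  With \<open>k = (l - 1) m\<close> it rearranges to \<open>v (l - 1 - m) = l m (l - 2)\<close>, which forces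
  \<open>m \<le> l - 2\<close>; that is \<open>k \<le> (l - 1) (l - 2)\<close>, the lower bound.\<close>

text \<open>Both sides count pairs \<open>(y, B)\<close> with \<open>y\<close> in
  \<open>S \<inter> B\<close>. Induction on \<open>M\<close> counts repeated blocks with
  multiplicity.\<close>

lemma sum_size_filter_mem:
  assumes "finite S"
  shows "(\<Sum>y\<in>S. size {#B \<in># M. P B \<and> y \<in> B#}) = (\<Sum>B\<in>#{#B \<in># M. P B#}. card (S \<inter> B))"
proof (induction M)
  case empty
  then show ?case by simp
next
  case (add A M)
  have "(\<Sum>y\<in>S. size {#B \<in># add_mset A M. P B \<and> y \<in> B#})
      = (\<Sum>y\<in>S. (if P A \<and> y \<in> A then 1 else 0) + size {#B \<in># M. P B \<and> y \<in> B#})"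
    by (rule sum.cong) auto
  also have "\<dots> = (if P A then card (S \<inter> A) else 0) + (\<Sum>y\<in>S. size {#B \<in># M. P B \<and> y \<in> B#})"
    using assms by (simp add: sum.distrib flip: sum.inter_restrict)
  finally show ?case
    using add.IH by simp
qed

text \<open>Double counting of pairs \<open>(y, B)\<close> with \<open>y \<in> S - {x}\<close> and
  \<open>x, y \<in> B\<close>. Leaving \<open>S\<close> free covers both all of \<open>V\<close> and
  the colour class of \<open>x\<close>.\<close>

lemma bibd_count_around_point:
  assumes "bibd v k lam V \<B>" and "x \<in> S" and "S \<subseteq> V"
    and inter: "\<And>B. B \<in># \<B> \<Longrightarrow> x \<in> B \<Longrightarrow> card (S \<inter> B) = j"
  shows "(card S - 1) * lam = size {#B \<in># \<B>. x \<in> B#} * (j - 1)"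
proof -
  from assms(1) have "finite V"
    and pair: "\<And>y. y \<in> V \<Longrightarrow> x \<noteq> y \<Longrightarrow> size {#B \<in># \<B>. x \<in> B \<and> y \<in> B#} = lam"
    using assms(2,3) unfolding bibd_def by auto
  then have fin: "finite S"
    using assms(3) finite_subset by blast
  have "(card S - 1) * lam = (\<Sum>y\<in>S - {x}. lam)"
    using fin assms(2) by simp
  also have "\<dots> = (\<Sum>y\<in>S - {x}. size {#B \<in># \<B>. x \<in> B \<and> y \<in> B#})"
    by (rule sum.cong) (use pair assms(3) in auto)
  also have "\<dots> = (\<Sum>B\<in>#{#B \<in># \<B>. x \<in> B#}. card ((S - {x}) \<inter> B))"
    by (rule sum_size_filter_mem) (use fin in simp)
  also have "\<dots> = (\<Sum>B\<in>#{#B \<in># \<B>. x \<in> B#}. j - 1)"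
  proof (intro arg_cong[of _ _ sum_mset] image_mset_cong)
    fix B assume "B \<in># {#B \<in># \<B>. x \<in> B#}"
    then have B: "B \<in># \<B>" "x \<in> B" by auto
    have "(S - {x}) \<inter> B = S \<inter> B - {x}" by auto
    then show "card ((S - {x}) \<inter> B) = j - 1"
      using inter[OF B] B(2) assms(2) fin by simp
  qed
  finally show ?thesis
    by (simp add: sum_mset_constant)
qed

lemma zero_ULSE_colour_class:
  assumes bibd: "bibd v k lam V \<B>" and col: "zero_ULSE_colouring l k V \<B> C f" and "c \<in> C"
  shows "(card {y \<in> V. f y = c} - 1) * (k - 1) = (v - 1) * (k div (l - 1) - 1)"
proof -
  let ?m = "k div (l - 1)"
  from bibd have "0 < lam" "card V = v"
    and block: "\<And>B. B \<in># \<B> \<Longrightarrow> B \<subseteq> V \<and> card B = k"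
    unfolding bibd_def by auto
  from col have "f ` V = C"
    and class_block: "\<And>B d. B \<in># \<B> \<Longrightarrow> d \<in> C \<inter> f ` B \<Longrightarrow> card {x \<in> B. f x = d} = ?m"
    unfolding zero_ULSE_colouring_def colouring_def by auto
  then obtain x where x: "x \<in> V" "f x = c"
    using \<open>c \<in> C\<close> by auto
  define r where "r = size {#B \<in># \<B>. x \<in> B#}"
  let ?S = "{y \<in> V. f y = c}"
  have all: "(v - 1) * lam = r * (k - 1)"
    unfolding r_def \<open>card V = v\<close>[symmetric]
    by (rule bibd_count_around_point[OF bibd x(1)]) (use block in \<open>auto simp: Int_absorb1\<close>)
  have own: "(card ?S - 1) * lam = r * (?m - 1)"
    unfolding r_def
  proof (rule bibd_count_around_point[OF bibd])
    fix B assume B: "B \<in># \<B>" "x \<in> B"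
    then have "?S \<inter> B = {y \<in> B. f y = c}"
      using block by blast
    then show "card (?S \<inter> B) = ?m"
      using class_block[OF B(1), of c] B(2) x(2) \<open>c \<in> C\<close> by auto
  qed (use x in auto)
  \<comment> \<open>Both sides equal \<open>r * (?m - 1) * (k - 1)\<close>, so \<open>r\<close>
    drops out.\<close>
  have "(card ?S - 1) * (k - 1) * lam = (v - 1) * (?m - 1) * lam"
  proof -
    have "(card ?S - 1) * (k - 1) * lam = r * (?m - 1) * (k - 1)"
      using arg_cong[OF own, of "\<lambda>t. (k - 1) * t"] by (simp only: ac_simps)
    also have "\<dots> = (v - 1) * (?m - 1) * lam"
      using arg_cong[OF all, of "\<lambda>t. (?m - 1) * t"] by (simp only: ac_simps)
    finally show ?thesis .
  qed
  with \<open>0 < lam\<close> show ?thesis by simp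
qed

lemma zero_ULSE_identity:
  assumes bibd: "bibd v k lam V \<B>" and col: "zero_ULSE_colouring l k V \<B> C f"
  shows "(v - l) * (k - 1) = l * ((v - 1) * (k div (l - 1) - 1))"
proof -
  from bibd have V: "finite V" "card V = v"
    unfolding bibd_def by auto
  from col have C: "finite C" "card C = l" "f ` V = C"
    unfolding zero_ULSE_colouring_def colouring_def by auto
  let ?n = "\<lambda>c. card {y \<in> V. f y = c}"
  \<comment> \<open>Surjectivity makes every class nonempty, so the truncated subtraction in the sum
    below is exact.\<close>
  have pos: "1 \<le> ?n c" if "c \<in> C" for c
    using that C(3) V(1) by (auto simp: Suc_le_eq card_gt_0_iff)
  have "v = (\<Sum>c\<in>C. ?n c)"
    using sum.group[OF V(1) C(1), of f "\<lambda>_. 1::nat"] C(3) V by simp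
  then have "(\<Sum>c\<in>C. ?n c - 1) = v - l"
    using sum_subtractf_nat[of C "\<lambda>_. 1" ?n] pos C(2) by simp
  then have "(v - l) * (k - 1) = (\<Sum>c\<in>C. (?n c - 1) * (k - 1))"
    by (simp flip: sum_distrib_right)
  also have "\<dots> = l * ((v - 1) * (k div (l - 1) - 1))"
    using zero_ULSE_colour_class[OF bibd col] C(2) by simp
  finally show ?thesis .
qed

theorem theorem3p7:
  fixes v k lam l :: nat
    and V :: "'a set" and \<B> :: "'a set multiset"
    and C :: "'c set" and f :: "'a \<Rightarrow> 'c"
  assumes "bibd v k lam V \<B>"
    and "zero_ULSE_colouring l k V \<B> C f"
    and "l < v"
  shows "(3 + sqrt (4 * real k + 1)) / 2 \<le> real l \<and> real l \<le> real k / 2 + 1"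
proof -
  define m where "m = k div (l - 1)"
  from assms(1) have k: "2 \<le> k"
    unfolding bibd_def by auto
  from assms(2) have "(l - 1) dvd k"
    unfolding zero_ULSE_colouring_def by auto
  then have km: "k = (l - 1) * m"
    unfolding m_def by simp
  \<comment> \<open>Otherwise \<open>l - 1 = 0\<close> and hence \<open>k = 0\<close>.\<close>
  with k have l: "2 \<le> l"
    by (cases "l \<le> 1") auto
  have ident: "(v - l) * (k - 1) = l * ((v - 1) * (m - 1))"
    using zero_ULSE_identity[OF assms(1,2)] unfolding m_def .
  moreover have "0 < (v - l) * (k - 1)"
    using assms(3) k by simp
  ultimately have m: "2 \<le> m"
    by (cases "m \<le> 1") auto
  have kr: "real k = (real l - 1) * real m"
    using km l by (simp add: of_nat_diff)
  have "real ((v - l) * (k - 1)) = real (l * ((v - 1) * (m - 1)))"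
    using ident by simp
  then have "(real v - real l) * (real k - 1) = real l * ((real v - 1) * (real m - 1))"
    using assms(3) k l m by (simp add: of_nat_diff)
  then have vl: "real v * (real l - 1 - real m) = real l * real m * (real l - 2)"
    unfolding kr by (simp add: algebra_simps)
  \<comment> \<open>For \<open>l = 2\<close> the right side of \<open>vl\<close> vanishes, while the
    left is \<open>v * (1 - m) < 0\<close>.\<close>
  have "l \<noteq> 2"
    using vl m assms(3) by auto
  with l have "0 < real l * real m * (real l - 2)"
    using m by simp
  then have "0 < real l - 1 - real m"
    unfolding vl[symmetric] by (simp add: zero_less_mult_iff)
  then have "real (m + 1) < real l"
    by simp
  then have "m + 2 \<le> l"
    unfolding of_nat_less_iff by simp
  then have "real m \<le> real l - 2"
    by linarith
  then have "real k \<le> (real l - 1) * (real l - 2)"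
    unfolding kr using l by (intro mult_left_mono) auto
  \<comment> \<open>Completing the square:
    \<open>4 * (l - 1) * (l - 2) + 1 = (2 * l - 3)\<^sup>2\<close>.\<close>
  then have "4 * real k + 1 \<le> (2 * real l - 3)\<^sup>2"
    by (simp add: power2_eq_square algebra_simps)
  then have "sqrt (4 * real k + 1) \<le> 2 * real l - 3"
    using l by (intro real_le_lsqrt) auto
  moreover have "(real l - 1) * 2 \<le> real k"
    unfolding kr using l m by (intro mult_left_mono) auto
  ultimately show ?thesis by simp
qed

end
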